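(* Let $q$ be a prime power, $\mathbb{F}_q$ the finite field with $q$ elements and $\overline{\mathbb{F}}_q$ its algebraic closure. Fix nonzero polynomials $f_1, \ldots, f_k\in \mathbb{F}_q[x]$, positive integers $d_1, \ldots, d_k$ and $b\in \overline{\mathbb{F}}_q$. Let $\ell$ be any positive integer divisible by each of $d_1, \ldots, d_k$, set $$G_{\ell}(x)=\gcd\left(x^{\ell}-1, \frac{f_1(x)(x^{\ell}-1)}{x^{d_1}-1}, \ldots, \frac{f_k(x)(x^{\ell}-1)}{x^{d_k}-1}\right)\quad\text{and}\quad H_{\ell}(x)=\frac{x^{\ell}-1}{G_{\ell}(x)}.$$ Then the equation $$L_{f_1}(x_1)+\cdots+L_{f_k}(x_k)=b$$ has a solution $(z_1, \ldots, z_k)\in \overline{\mathbb{F}}_q^k$ with $z_i\in \mathbb{F}_{q^{d_i}}$ for all $1\le i\le k$ if and only if $L_{H_{\ell}}(b)=0$. In this case, the number of such solutions equals $q^{d_1+\cdots+d_k-\deg(H_\ell(x))}$.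
   Context: For a polynomial $f\in \mathbb{F}_q[x]$ with $f(x)=\sum_{i=0}^m a_ix^i$, its $q$-associate is $L_f(x)=\sum_{i=0}^m a_ix^{q^i}$. Here $\mathbb{F}_{q^{d}}$ denotes the unique subfield of $\overline{\mathbb{F}}_q$ with $q^d$ elements. *)

theory Defs
  imports
    "HOL-Algebra.Algebraic_Closure_Type"
    "HOL-Library.Cardinality"
    "HOL-Library.FuncSet"
begin

text \<open>
  The base field is a finite type \<open>'a\<close> of sort \<open>field_gcd\<close>, i.e. a field carrying the gcd operations
  (trivial on a field) from which the library builds the monic gcd on \<open>'a poly\<close>. Its algebraic
  closure is the type \<open>'a alg_closure\<close> with embedding \<open>to_ac\<close>. Names such as \<open>degree\<close> are
  qualified because \<open>HOL-Algebra\<close> has list-based polynomials with the same names.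
\<close>

definition q_associate :: "nat \<Rightarrow> 'a::field poly \<Rightarrow> 'a poly" where
  "q_associate q f =
     (\<Sum>i\<le>Polynomial.degree f. Polynomial.monom (Polynomial.coeff f i) (q ^ i))"

definition q_associate_eval :: "nat \<Rightarrow> 'a::field poly \<Rightarrow> 'a alg_closure \<Rightarrow> 'a alg_closure" where
  "q_associate_eval q f x = poly (map_poly to_ac (q_associate q f)) x"

text \<open>
  The unique subfield with \<open>n\<close> elements; meaningful when \<open>'a\<close> is finite and \<open>n\<close> is a positive
  power of its cardinality.
\<close>

definition subfield_of_card :: "nat \<Rightarrow> 'a::field alg_closure set" where
  "subfield_of_card n = (THE K. subfield K ring_of_type_algebra \<and> card K = n)"

definition x_pow_minus_1 :: "nat \<Rightarrow> 'a::field poly" where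
  "x_pow_minus_1 n = Polynomial.monom 1 n - 1"

text \<open>
  In the two definitions below \<open>div\<close> is exact division whenever every \<open>d i\<close> divides \<open>l\<close>.
\<close>

definition G_poly ::
  "nat \<Rightarrow> (nat \<Rightarrow> 'a::field_gcd poly) \<Rightarrow> (nat \<Rightarrow> nat) \<Rightarrow> nat \<Rightarrow> 'a poly" where
  "G_poly k f d l =
     Gcd (insert (x_pow_minus_1 l)
       ((\<lambda>i. (f i * x_pow_minus_1 l) div x_pow_minus_1 (d i)) ` {1..k}))"

definition H_poly ::
  "nat \<Rightarrow> (nat \<Rightarrow> 'a::field_gcd poly) \<Rightarrow> (nat \<Rightarrow> nat) \<Rightarrow> nat \<Rightarrow> 'a poly" where
  "H_poly k f d l = x_pow_minus_1 l div G_poly k f d l"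

text \<open>
  Tuples indexed by \<open>1, \<dots>, k\<close> are extensional functions, so that each tuple is counted once.
\<close>

definition solutions ::
  "nat \<Rightarrow> nat \<Rightarrow> (nat \<Rightarrow> 'a::field poly) \<Rightarrow> (nat \<Rightarrow> nat) \<Rightarrow> 'a alg_closure
     \<Rightarrow> (nat \<Rightarrow> 'a alg_closure) set" where
  "solutions q k f d b =
     {z \<in> PiE {1..k} (\<lambda>i. subfield_of_card (q ^ d i)). (\<Sum>i=1..k. q_associate_eval q (f i) (z i)) = b}"

end

theory Submission
  imports Defs
begin

text \<open>
  Let \<open>\<phi>\<close> be the Frobenius map \<open>x \<mapsto> x^q\<close>; then \<open>L\<^sub>f = f(\<phi>)\<close>, so \<open>f \<mapsto> L\<^sub>f\<close> is a ring homomorphism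
  from polynomials to additive endomorphisms of the closure, and the subfield
  with \<open>q^n\<close> elements is the kernel of \<open>L\<^bsub>x^n - 1\<^esub>\<close>. A nonzero \<open>L\<^sub>h\<close> is surjective, so \<open>g h = x^l - 1\<close> implies
  \<open>ker L\<^sub>g = L\<^sub>h (ker L\<^bsub>x^l - 1\<^esub>)\<close>. Applied to \<open>g = x^(d i) - 1\<close> this parametrizes every variable by the
  field with \<open>q^l\<close> elements; by Bezout the values of the left-hand side are then exactly
  \<open>L\<^sub>G (ker L\<^bsub>x^l - 1\<^esub>) = ker L\<^sub>H\<close>, a space with \<open>q^(deg H)\<close> elements because \<open>L\<^sub>H\<close> is separable. The
  fibres of an additive map all have the same size.
\<close>

subsection \<open>Finite fields\<close>

text \<open>Multiplication by a nonzero \<open>x\<close> permutes \<open>K - {0}\<close>, so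
  comparing the products of all elements gives \<open>x ^ card (K - {0}) = 1\<close>. Taking
  \<open>K\<close> as a subset of a field covers both the whole base field and a subfield of the
  closure.\<close>

lemma power_card_eq_self:
  fixes K :: "'a::field set"
  assumes "finite K" "0 \<in> K" and mult: "\<And>x y. x \<in> K \<Longrightarrow> y \<in> K \<Longrightarrow> x * y \<in> K" and "x \<in> K"
  shows "x ^ card K = x"
proof (cases "x = 0")
  case True
  then show ?thesis using assms by (auto simp: power_0_left card_eq_0_iff)
next
  case False
  have inj: "inj_on ((*) x) (K - {0})" using False by (auto simp: inj_on_def)
  have im: "(*) x ` (K - {0}) = K - {0}"
    using assms False inj by (intro endo_inj_surj) auto
  have "\<Prod>(K - {0}) = (\<Prod>y\<in>K - {0}. x * y)"
    using prod.reindex[OF inj, of "\<lambda>y. y"] im by simp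
  also have "\<dots> = x ^ card (K - {0}) * \<Prod>(K - {0})" by (simp add: prod.distrib)
  finally have "x ^ card (K - {0}) = 1" using assms by simp
  moreover have "card K = Suc (card (K - {0}))" using assms card.remove by metis
  ultimately show ?thesis by simp
qed

lemma CARD_field_gt_1: "CARD('a::{finite,field}) > 1"
proof -
  have "card {0, 1 :: 'a} \<le> CARD('a)" by (rule card_mono) auto
  then show ?thesis by simp
qed

lemma to_ac_power_CARD: "to_ac (c :: 'a::{finite,field}) ^ CARD('a) = to_ac c"
  using power_card_eq_self[of "UNIV :: 'a set" c] by (metis UNIV_I finite to_ac_power)

text \<open>Translation by 1 permutes the base field, so the sum of its elements does not change
  when 1 is added \<open>CARD('a)\<close> times.\<close>

lemma of_nat_CARD_alg_closure: "of_nat CARD('a) = (0 :: 'a::{finite,field} alg_closure)"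
proof -
  have "sum (\<lambda>x. x) (UNIV :: 'a set) = (\<Sum>x\<in>UNIV. x + 1)"
    by (rule sum.reindex_bij_witness[of _ "\<lambda>x. x + 1" "\<lambda>x. x - 1"]) auto
  then have "of_nat CARD('a) = (0 :: 'a)" by (simp add: sum.distrib)
  then show ?thesis by (metis to_ac_0 to_ac_of_nat)
qed

text \<open>
  Both sides are monic of degree \<open>q\<close> in \<open>x\<close> and agree at the \<open>q\<close> elements of the base field, provided
  that \<open>y\<close> is in the base field too. Exchanging the roles of \<open>x\<close> and \<open>y\<close> removes this proviso.
\<close>
lemma add_power_CARD:
  fixes x y :: "'a::{finite,field} alg_closure"
  shows "(x + y) ^ CARD('a) = x ^ CARD('a) + y ^ CARD('a)"
proof -
  let ?q = "CARD('a)" and ?R = "range (to_ac :: 'a \<Rightarrow> _)"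
  have q: "?q > 0" by simp
  have step: "(x + y) ^ ?q = x ^ ?q + y ^ ?q"
    if y: "\<And>z. z \<in> ?R \<Longrightarrow> (z + y) ^ ?q = z ^ ?q + y ^ ?q" for x y :: "'a alg_closure"
  proof -
    have 1: "Polynomial.degree ([:y, 1:] ^ ?q) = ?q"
      by (simp add: degree_power_eq)
    have 2: "Polynomial.degree (Polynomial.monom 1 ?q + [:y ^ ?q:]) = ?q"
      using q by (subst degree_add_eq_left) (auto simp: Polynomial.degree_monom_eq)
    have "[:y, 1:] ^ ?q = Polynomial.monom 1 ?q + [:y ^ ?q:]"
    proof (rule poly_eqI_degree_lead_coeff[where n = ?q and A = ?R])
      have "Polynomial.coeff ([:y, 1:] ^ ?q) ?q = 1"
        using lead_coeff_power[of "[:y, 1:]" ?q] 1 by simp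
      moreover have "Polynomial.coeff [:y ^ ?q:] ?q = 0"
        using q by (intro coeff_eq_0) simp
      ultimately show "Polynomial.coeff ([:y, 1:] ^ ?q) ?q =
          Polynomial.coeff (Polynomial.monom 1 ?q + [:y ^ ?q:]) ?q" by simp
      show "?q \<le> card ?R" by (simp add: card_image inj_to_ac)
      show "poly ([:y, 1:] ^ ?q) z = poly (Polynomial.monom 1 ?q + [:y ^ ?q:]) z" if "z \<in> ?R" for z
        using y[OF that] by (simp add: poly_power poly_monom add.commute)
    qed (use 1 2 in auto)
    then have "poly ([:y, 1:] ^ ?q) x = poly (Polynomial.monom 1 ?q + [:y ^ ?q:]) x" by simp
    then show ?thesis by (simp add: poly_power poly_monom add.commute)
  qed
  have base: "(z + w) ^ ?q = z ^ ?q + w ^ ?q" if "z \<in> ?R" "w \<in> ?R" for z w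
    using that by (auto simp: to_ac_power_CARD simp flip: to_ac_add)
  have "(z + y) ^ ?q = z ^ ?q + y ^ ?q" if "z \<in> ?R" for z
    using step[of z y] base that by (metis add.commute)
  then show ?thesis by (rule step)
qed

subsection \<open>The associate as a module action\<close>

abbreviation assoc_eval :: "'a::{finite,field} poly \<Rightarrow> 'a alg_closure \<Rightarrow> 'a alg_closure" where
  "assoc_eval \<equiv> q_associate_eval CARD('a)"

text \<open>The free bound \<open>n\<close> allows polynomials of different degrees to be expanded
  over a common range, as in the proof of additivity in \<open>f\<close>.\<close>

lemma q_associate_eval_altdef:
  assumes "Polynomial.degree f \<le> n"
  shows "q_associate_eval q f x = (\<Sum>i\<le>n. to_ac (Polynomial.coeff f i) * x ^ (q ^ i))"
proof -
  have add: "map_poly to_ac (g + h) = map_poly to_ac g + map_poly to_ac h" for g h :: "'a poly"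
    by (intro poly_eqI) (simp add: coeff_map_poly)
  have "map_poly to_ac (sum g A) = (\<Sum>i\<in>A. map_poly to_ac (g i))" if "finite A"
    for g :: "nat \<Rightarrow> 'a poly" and A
    using that by induction (auto simp: add)
  then have "q_associate_eval q f x =
      (\<Sum>i\<le>Polynomial.degree f. to_ac (Polynomial.coeff f i) * x ^ (q ^ i))"
    by (simp add: q_associate_eval_def q_associate_def poly_sum map_poly_monom poly_monom)
  also have "\<dots> = (\<Sum>i\<le>n. to_ac (Polynomial.coeff f i) * x ^ (q ^ i))"
    using assms by (intro sum.mono_neutral_left) (auto simp: coeff_eq_0)
  finally show ?thesis .
qed

lemma q_associate_eval_0_left [simp]: "q_associate_eval q 0 x = 0"
  by (simp add: q_associate_eval_altdef[of _ 0])

lemma q_associate_eval_add_left: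
  "q_associate_eval q (f + g) x = q_associate_eval q f x + q_associate_eval q g x"
proof -
  let ?n = "max (Polynomial.degree f) (Polynomial.degree g)"
  show ?thesis
    by (simp add: q_associate_eval_altdef[of _ ?n] degree_add_le sum.distrib distrib_right)
qed

lemma q_associate_eval_smult: "q_associate_eval q (smult c f) x = to_ac c * q_associate_eval q f x"
  by (simp add: q_associate_eval_altdef[of _ "Polynomial.degree f"] sum_distrib_left mult_ac)

text \<open>A Horner-type recursion: the variable of the polynomial acts as the \<open>q\<close>-th
  power. The inductions that use it generalize \<open>x\<close>, because the argument becomes
  \<open>x ^ q\<close>.\<close>

lemma q_associate_eval_pCons:
  "q_associate_eval q (pCons c f) x = to_ac c * x + q_associate_eval q f (x ^ q)"
proof -
  have "q_associate_eval q (pCons c f) x =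
      (\<Sum>i\<le>Suc (Polynomial.degree f). to_ac (Polynomial.coeff (pCons c f) i) * x ^ (q ^ i))"
    by (intro q_associate_eval_altdef) (simp add: degree_pCons_le)
  then show ?thesis
    by (simp add: sum.atMost_Suc_shift q_associate_eval_altdef[of f "Polynomial.degree f"] power_mult
      del: sum.atMost_Suc)
qed

lemma q_associate_eval_1_left [simp]: "q_associate_eval q 1 x = x"
  using q_associate_eval_pCons[of q 1 0 x] by (simp flip: one_pCons)

lemma assoc_eval_add_right: "assoc_eval f (x + y) = assoc_eval f x + assoc_eval f y"
  by (induction f arbitrary: x y) (auto simp: q_associate_eval_pCons add_power_CARD algebra_simps)

lemma assoc_eval_0_right [simp]: "assoc_eval f 0 = 0"
  using assoc_eval_add_right[of f 0 0] by (simp only: add_0_left add_cancel_right_right)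

lemma assoc_eval_diff_right: "assoc_eval f (x - y) = assoc_eval f x - assoc_eval f y"
  using assoc_eval_add_right[of f "x - y" y] by simp

lemma assoc_eval_sum_right: "assoc_eval f (sum g A) = (\<Sum>i\<in>A. assoc_eval f (g i))"
  by (induction A rule: infinite_finite_induct) (auto simp: assoc_eval_add_right)

text \<open>Frobenius fixes the coefficients, which come from the base field, and therefore commutes
  with the action.\<close>

lemma assoc_eval_power_CARD:
  "assoc_eval f (x ^ CARD('a)) = assoc_eval (f :: 'a::{finite,field} poly) x ^ CARD('a)"
  by (induction f arbitrary: x)
    (auto simp: q_associate_eval_pCons add_power_CARD power_mult_distrib to_ac_power_CARD)

text \<open>The recursion on \<open>f\<close> produces a Frobenius power inside
  \<open>assoc_eval g\<close>; commutation with Frobenius moves it outside.\<close>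

lemma assoc_eval_mult: "assoc_eval (f * g) x = assoc_eval f (assoc_eval g x)"
  by (induction f arbitrary: x)
    (auto simp: q_associate_eval_pCons q_associate_eval_add_left q_associate_eval_smult
      assoc_eval_power_CARD)

lemma assoc_eval_x_pow_minus_1:
  "assoc_eval (x_pow_minus_1 n) x = x ^ (CARD('a) ^ n) - (x :: 'a::{finite,field} alg_closure)"
proof -
  have "assoc_eval (Polynomial.monom 1 n) x = x ^ (CARD('a) ^ n)"
    by (induction n arbitrary: x) (auto simp: monom_Suc q_associate_eval_pCons power_mult)
  moreover have "x_pow_minus_1 n + 1 = (Polynomial.monom 1 n :: 'a poly)"
    by (simp add: x_pow_minus_1_def)
  then have "assoc_eval (x_pow_minus_1 n) x + x = assoc_eval (Polynomial.monom 1 n) x"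
    using q_associate_eval_add_left[of "CARD('a)" "x_pow_minus_1 n" 1 x] by simp
  ultimately show ?thesis by (simp add: algebra_simps)
qed

subsection \<open>Kernels\<close>

text \<open>A repeated linear factor would give a root of the derivative, so the multiset of roots
  in the factorization is a set.\<close>

lemma card_roots_separable:
  fixes p :: "'a::alg_closed_field poly"
  assumes "\<And>x. poly (pderiv p) x \<noteq> 0" and "p \<noteq> 0"
  shows "card {x. poly p x = 0} = Polynomial.degree p"
proof -
  obtain A c where A: "size A = Polynomial.degree p" "p = smult c (\<Prod>x\<in>#A. [:-x, 1:])"
    using alg_closed_imp_factorization[OF assms(2)] by blast
  have root: "poly p x = 0 \<longleftrightarrow> x \<in># A" for x
    using assms(2) unfolding A(2) by (auto simp: poly_prod_mset)
  have "count A x = 1" if "x \<in># A" for x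
  proof -
    obtain B where B: "A = add_mset x B" using multi_member_split[OF \<open>x \<in># A\<close>] by blast
    have "x \<notin># B"
    proof
      assume "x \<in># B"
      then obtain C where C: "B = add_mset x C" by (blast dest: multi_member_split)
      have p: "p = [:-x, 1:] * ([:-x, 1:] * smult c (\<Prod>x\<in>#C. [:-x, 1:]))"
        by (simp only: A(2) B C image_mset_add_mset prod_mset.add_mset mult_smult_right)
      have "poly [:-x, 1:] x = 0" by simp
      \<comment> \<open>Both summands of the product rule keep a factor
        \<open>[:-x, 1:]\<close>.\<close>
      then have "poly (pderiv p) x = 0"
        unfolding p pderiv_mult poly_add poly_mult by (simp only: mult_zero_left mult_zero_right add_0_left)
      with assms show False by blast
    qed
    then show ?thesis using B by (simp add: not_in_iff)
  qed
  then have "sum (count A) (set_mset A) = (\<Sum>x\<in>set_mset A. 1)"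
    by (intro sum.cong) auto
  then have "size A = card (set_mset A)" by (simp only: size_multiset_overloaded_eq card_eq_sum)
  also have "set_mset A = {x. poly p x = 0}" using root by auto
  finally show ?thesis using A(1) by simp
qed

lemma coeff_q_associate:
  assumes "q > 1"
  shows "Polynomial.coeff (q_associate q f) (q ^ n) = Polynomial.coeff f n"
  using assms by (auto simp: q_associate_def coeff_sum coeff_eq_0)

lemma degree_q_associate:
  assumes "q > 1" "f \<noteq> 0"
  shows "Polynomial.degree (q_associate q f) = q ^ Polynomial.degree f"
proof (rule antisym)
  show "Polynomial.degree (q_associate q f) \<le> q ^ Polynomial.degree f"
    unfolding q_associate_def using assms
    by (intro degree_sum_le) (auto intro!: order.trans[OF degree_monom_le] power_increasing)
  show "q ^ Polynomial.degree f \<le> Polynomial.degree (q_associate q f)"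
    using assms by (intro le_degree) (simp add: coeff_q_associate)
qed

lemma degree_map_poly_to_ac: "Polynomial.degree (map_poly to_ac p) = Polynomial.degree p"
  by (intro degree_map_poly) auto

text \<open>The exponents \<open>q ^ i\<close> with \<open>i > 0\<close> vanish in the closure, so
  the derivative of the associate is the constant \<open>coeff f 0\<close>. As this is nonzero,
  there are as many roots as the degree.\<close>

lemma card_ker_assoc_eval:
  fixes f :: "'a::{finite,field} poly"
  assumes "Polynomial.coeff f 0 \<noteq> 0"
  shows "card {x. assoc_eval f x = 0} = CARD('a) ^ Polynomial.degree f"
proof -
  let ?q = "CARD('a)"
  let ?p = "map_poly to_ac (q_associate ?q f)"
  have q: "?q > 1" by (rule CARD_field_gt_1)
  have f: "f \<noteq> 0" using assms by auto
  have dvd: "of_nat (?q ^ i) = (0 :: 'a alg_closure)" if "i \<noteq> 0" for i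
    using that of_nat_CARD_alg_closure[where 'a = 'a] by (cases i) auto
  have eq: "?p = (\<Sum>i\<le>Polynomial.degree f.
      Polynomial.monom (to_ac (Polynomial.coeff f i)) (?q ^ i))"
    by (intro poly_eqI) (simp add: coeff_map_poly q_associate_def coeff_sum to_ac_sum if_distrib cong: if_cong)
  have "pderiv ?p = (\<Sum>i\<le>Polynomial.degree f.
      pderiv (Polynomial.monom (to_ac (Polynomial.coeff f i)) (?q ^ i)))"
    unfolding eq by (rule sum_comp_morphism[of pderiv, unfolded o_def, symmetric])
      (simp_all add: pderiv_add)
  also have "\<dots> = (\<Sum>i\<in>{0}. pderiv (Polynomial.monom (to_ac (Polynomial.coeff f i)) (?q ^ i)))"
    using dvd by (intro sum.mono_neutral_right) (auto simp: pderiv_monom)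
  finally have "pderiv ?p = [:to_ac (Polynomial.coeff f 0):]"
    by (simp add: pderiv_monom monom_0)
  then have "card {x. poly ?p x = 0} = Polynomial.degree ?p"
    using assms by (intro card_roots_separable) auto
  then show ?thesis
    unfolding q_associate_eval_def[symmetric] degree_map_poly_to_ac degree_q_associate[OF q f] .
qed

text \<open>The associate has positive degree even for constant \<open>f\<close>, so subtracting
  \<open>y\<close> leaves a nonconstant polynomial, which has a root.\<close>

lemma assoc_eval_surj:
  fixes f :: "'a::{finite,field} poly"
  assumes "f \<noteq> 0"
  obtains x where "assoc_eval f x = y"
proof -
  let ?p = "map_poly to_ac (q_associate CARD('a) f)"
  have deg: "Polynomial.degree ?p > 0"
    unfolding degree_map_poly_to_ac degree_q_associate[OF CARD_field_gt_1 assms] by simp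
  then have "Polynomial.degree (?p - [:y:]) > 0" 
    using degree_add_eq_left[of "- [:y:]" ?p] by (simp only: diff_conv_add_uminus degree_minus degree_pCons_0)
  then obtain x where "poly (?p - [:y:]) x = 0" using alg_closed_imp_poly_has_root by blast
  then show ?thesis by (intro that[of x]) (simp add: q_associate_eval_def)
qed

lemma ker_assoc_eval_factor:
  fixes g h :: "'a::{finite,field} poly"
  assumes "h \<noteq> 0"
  shows "{x. assoc_eval g x = 0} = assoc_eval h ` {x. assoc_eval (g * h) x = 0}"
proof (intro equalityI subsetI)
  fix y assume y: "y \<in> {x. assoc_eval g x = 0}"
  obtain x where "assoc_eval h x = y" using assoc_eval_surj[OF assms] .
  then show "y \<in> assoc_eval h ` {x. assoc_eval (g * h) x = 0}"
    using y by (auto simp: assoc_eval_mult intro!: image_eqI[of _ _ x])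
qed (auto simp: assoc_eval_mult)

lemma coeff_0_x_pow_minus_1: "n > 0 \<Longrightarrow> Polynomial.coeff (x_pow_minus_1 n) 0 = -1"
  by (simp add: x_pow_minus_1_def)

lemma x_pow_minus_1_nonzero: "n > 0 \<Longrightarrow> x_pow_minus_1 n \<noteq> 0"
  by (metis coeff_0 coeff_0_x_pow_minus_1 neg_equal_0_iff_equal zero_neq_one)

lemma degree_x_pow_minus_1:
  "Polynomial.degree (x_pow_minus_1 n :: 'a::field poly) = n"
proof (cases "n = 0")
  case False
  then have "Polynomial.degree (Polynomial.monom 1 n + (-1 :: 'a poly)) = n"
    by (subst degree_add_eq_left) (auto simp: Polynomial.degree_monom_eq)
  then show ?thesis by (simp add: x_pow_minus_1_def)
qed (simp add: x_pow_minus_1_def)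

lemma x_pow_minus_1_dvd: "m dvd n \<Longrightarrow> x_pow_minus_1 m dvd x_pow_minus_1 n"
proof -
  assume "m dvd n"
  then obtain k where k: "n = m * k" by blast
  have "x_pow_minus_1 n = Polynomial.monom 1 m ^ k - 1"
    by (simp add: x_pow_minus_1_def k monom_power)
  then show ?thesis by (metis dvd_triv_left power_diff_1_eq x_pow_minus_1_def)
qed

text \<open>The kernel is the fixed set of an iterate of Frobenius, hence a subfield, and
  separability gives its size. Any subfield of that size is fixed by the same iterate, so it lies in
  the kernel and equals it by cardinality.\<close>

lemma subfield_of_card_eq_ker:
  assumes n: "n > 0"
  shows "subfield_of_card (CARD('a) ^ n) =
    {x :: 'a::{finite,field} alg_closure. assoc_eval (x_pow_minus_1 n) x = 0}"
proof -
  let ?N = "CARD('a) ^ n"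
  let ?R = "ring_of_type_algebra :: 'a alg_closure ring"
  let ?S = "{x :: 'a alg_closure. assoc_eval (x_pow_minus_1 n) x = 0}"
  have mem: "x \<in> ?S \<longleftrightarrow> x ^ ?N = x" for x by (simp add: assoc_eval_x_pow_minus_1)
  have card: "card ?S = ?N"
    using n by (subst card_ker_assoc_eval) (auto simp: coeff_0_x_pow_minus_1 degree_x_pow_minus_1)
  interpret R: field ?R by (rule field_from_type_algebra)
  have R [simp]: "carrier ?R = UNIV" "\<zero>\<^bsub>?R\<^esub> = 0" "\<one>\<^bsub>?R\<^esub> = 1"
      "x \<otimes>\<^bsub>?R\<^esub> y = x * y" "x \<oplus>\<^bsub>?R\<^esub> y = x + y" for x y
    by (auto simp: ring_of_type_algebra_def)
  have minus [simp]: "\<ominus>\<^bsub>?R\<^esub> x = - x" for x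
    using R.minus_equality[of "- x" x] by simp
  have inv: "inv\<^bsub>?R\<^esub> x = inverse x" if "x \<noteq> 0" for x
    using R.comm_inv_char[of x "inverse x"] that by simp
  have "subfield ?S ?R"
  proof (rule R.subfieldI')
    show "subring ?S ?R"
    proof (rule R.subringI)
      show "\<one>\<^bsub>?R\<^esub> \<in> ?S" unfolding mem by simp
      show "\<ominus>\<^bsub>?R\<^esub> h \<in> ?S" if "h \<in> ?S" for h
        using that assoc_eval_diff_right[of "x_pow_minus_1 n" 0 h] by simp
      show "h1 \<otimes>\<^bsub>?R\<^esub> h2 \<in> ?S" if "h1 \<in> ?S" "h2 \<in> ?S" for h1 h2
        using that unfolding mem by (simp add: power_mult_distrib)
      show "h1 \<oplus>\<^bsub>?R\<^esub> h2 \<in> ?S" if "h1 \<in> ?S" "h2 \<in> ?S" for h1 h2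
        using that by (simp add: assoc_eval_add_right)
    qed simp
    show "inv\<^bsub>?R\<^esub> k \<in> ?S" if "k \<in> ?S - {\<zero>\<^bsub>?R\<^esub>}" for k
      using that unfolding Diff_iff mem by (simp add: inv power_inverse)
  qed
  moreover have "K = ?S" if "subfield K ?R" "card K = ?N" for K
  proof -
    have fin: "finite K" using that(2) by (intro card_ge_0_finite) simp
    note K = subringE[OF subfieldE(1)[OF that(1)]]
    have "x \<in> ?S" if "x \<in> K" for x
      unfolding mem using power_card_eq_self[of K x] fin K that \<open>card K = ?N\<close> by simp
    moreover have "finite ?S" using card by (intro card_ge_0_finite) simp
    ultimately show ?thesis using card that by (intro card_subset_eq) auto
  qed
  ultimately show ?thesis
    unfolding subfield_of_card_def using card by (intro the_equality conjI) blast+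
qed

subsection \<open>Values and fibres\<close>

text \<open>\<open>P\<close> describes an ideal containing \<open>S\<close>; each Bezout combination
  keeps the accumulated gcd inside it.\<close>

lemma Gcd_in_ideal:
  fixes S :: "'a::euclidean_ring_gcd set"
  assumes "finite S" and "P 0" and "\<And>x y. P x \<Longrightarrow> P y \<Longrightarrow> P (x + y)"
    and "\<And>x c. P x \<Longrightarrow> P (c * x)" and "\<And>x. x \<in> S \<Longrightarrow> P x"
  shows "P (Gcd S)"
  using assms(1,5)
proof (induction S)
  case (insert a S)
  obtain u v where "bezout_coefficients a (Gcd S) = (u, v)" by fastforce
  then have "Gcd (insert a S) = u * a + v * Gcd S" by (simp add: bezout_coefficients)
  then show ?case using insert assms by simp
qed (simp add: assms)

lemma finite_ker_assoc_eval:
  "Polynomial.coeff f 0 \<noteq> 0 \<Longrightarrow> finite {x. assoc_eval f x = 0}"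
  using card_ker_assoc_eval[of f] by (intro card_ge_0_finite) simp

theorem theorem1p1:
  fixes f :: "nat \<Rightarrow> 'a::{finite, field_gcd} poly"
    and d :: "nat \<Rightarrow> nat"
    and b :: "'a alg_closure"
    and q k l :: nat
  assumes "q = CARD('a)"
    and "k \<ge> 1"
    and "\<And>i. i \<in> {1..k} \<Longrightarrow> f i \<noteq> 0"
    and "\<And>i. i \<in> {1..k} \<Longrightarrow> d i > 0"
    and "l > 0"
    and "\<And>i. i \<in> {1..k} \<Longrightarrow> d i dvd l"
  shows "((\<exists>z. z \<in> solutions q k f d b) \<longleftrightarrow> q_associate_eval q (H_poly k f d l) b = 0) \<and>
    ((\<exists>z. z \<in> solutions q k f d b) \<longrightarrow>
      real (card (solutions q k f d b)) =
        real q powi (int (\<Sum>i=1..k. d i) - int (Polynomial.degree (H_poly k f d l))))"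
proof -
  define I where "I = {1..k}"
  define E :: "'a poly" where "E = x_pow_minus_1 l"
  \<comment> \<open>The cofactor \<open>e i\<close> will map \<open>F\<close>, the field with
    \<open>q ^ l\<close> elements, onto the range of the variable with index
    \<open>i\<close>.\<close>
  define e where "e i = E div x_pow_minus_1 (d i)" for i
  define F where "F = {x :: 'a alg_closure. assoc_eval E x = 0}"
  define V where "V = (\<Pi>\<^sub>E i\<in>I. {x :: 'a alg_closure. assoc_eval (x_pow_minus_1 (d i)) x = 0})"
  define T where "T z = (\<Sum>i\<in>I. assoc_eval (f i) (z i))" for z
  define G where "G = G_poly k f d l"
  define H where "H = H_poly k f d l"
  note d = assms(4)[folded I_def]
  have q: "q > 1" unfolding assms(1) by (rule CARD_field_gt_1)
  have I [simp]: "finite I" by (simp add: I_def)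
  have sol: "solutions q k f d c = {z \<in> V. T z = c}" for c
  proof -
    have "V = (\<Pi>\<^sub>E i\<in>{1..k}. subfield_of_card (q ^ d i))"
      unfolding V_def I_def assms(1) using assms(4) by (intro PiE_cong) (simp add: subfield_of_card_eq_ker)
    then show ?thesis by (simp add: solutions_def T_def I_def assms(1))
  qed
  have e: "x_pow_minus_1 (d i) * e i = E" if "i \<in> I" for i
    using that assms(6)[folded I_def] by (simp add: e_def E_def x_pow_minus_1_dvd)
  have E0: "E \<noteq> 0" "Polynomial.coeff E 0 \<noteq> 0"
    using assms(5) by (auto simp: E_def x_pow_minus_1_nonzero coeff_0_x_pow_minus_1)
  have G_eq: "G = Gcd (insert E ((\<lambda>i. f i * e i) ` I))"
  proof -
    have "f i * E div x_pow_minus_1 (d i) = f i * e i" if "i \<in> I" for i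
      using e[OF that] unfolding e_def by (metis div_mult_swap dvd_triv_left)
    then show ?thesis by (simp add: G_def G_poly_def E_def I_def cong: image_cong_simp)
  qed
  have "G dvd E" unfolding G_eq by (rule Gcd_dvd) simp
  then have HG: "H * G = E" by (simp add: H_def H_poly_def G_def E_def)
  \<comment> \<open>Constant terms multiply and that of \<open>E\<close> is nonzero, so that of
    \<open>H\<close> is too; this makes the kernel of \<open>H\<close> countable by
    separability.\<close>
  have H0: "Polynomial.coeff H 0 \<noteq> 0" "G \<noteq> 0" using E0 HG[symmetric] by (auto simp: coeff_mult)

  have F: "{x. assoc_eval (x_pow_minus_1 (d i)) x = 0} = assoc_eval (e i) ` F" if "i \<in> I" for i
  proof -
    have "e i \<noteq> 0" using e[OF that] E0 by auto
    from ker_assoc_eval_factor[OF this, of "x_pow_minus_1 (d i)"] show ?thesis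
      unfolding e[OF that] F_def .
  qed
  \<comment> \<open>Polynomial multiplication commutes, so every polynomial preserves the kernel of
    \<open>E\<close>.\<close>
  have Fc: "assoc_eval c w \<in> F" if "w \<in> F" for c w
  proof -
    have "assoc_eval E (assoc_eval c w) = assoc_eval c (assoc_eval E w)"
      by (metis assoc_eval_mult mult.commute)
    with that show ?thesis by (simp add: F_def)
  qed
  \<comment> \<open>With all parameters in the single set \<open>F\<close>, each summand becomes the
    action of \<open>f i * e i\<close>, one of the generators of \<open>G\<close>.\<close>
  have imT: "c \<in> T ` V \<longleftrightarrow> (\<exists>w\<in>I \<rightarrow> F. c = (\<Sum>i\<in>I. assoc_eval (f i * e i) (w i)))" for c
  proof
    assume "c \<in> T ` V"
    then obtain z where z: "z \<in> V" "c = T z" by blast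
    have "\<forall>i\<in>I. \<exists>w. w \<in> F \<and> z i = assoc_eval (e i) w" using z(1) F by (fastforce simp: V_def PiE_iff)
    then obtain w where w: "\<And>i. i \<in> I \<Longrightarrow> w i \<in> F \<and> z i = assoc_eval (e i) (w i)" by metis
    then show "\<exists>w\<in>I \<rightarrow> F. c = (\<Sum>i\<in>I. assoc_eval (f i * e i) (w i))"
      using z(2) by (intro bexI[of _ w]) (auto simp: T_def assoc_eval_mult)
  next
    assume "\<exists>w\<in>I \<rightarrow> F. c = (\<Sum>i\<in>I. assoc_eval (f i * e i) (w i))"
    then obtain w where w: "w \<in> I \<rightarrow> F" "c = (\<Sum>i\<in>I. assoc_eval (f i * e i) (w i))" by blast
    then have "(\<lambda>i\<in>I. assoc_eval (e i) (w i)) \<in> V" using F by (auto simp: V_def)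
    moreover have "c = T (\<lambda>i\<in>I. assoc_eval (e i) (w i))" using w by (simp add: T_def assoc_eval_mult)
    ultimately show "c \<in> T ` V" by blast
  qed
  have image_T: "T ` V = {x. assoc_eval H x = 0}"
  proof -
    have "T ` V = assoc_eval G ` F"
    proof (intro equalityI subsetI)
      fix c assume "c \<in> T ` V"
      then obtain w where w: "w \<in> I \<rightarrow> F" "c = (\<Sum>i\<in>I. assoc_eval (f i * e i) (w i))"
        unfolding imT by blast
      \<comment> \<open>The common factor \<open>G\<close> can be pulled out of the whole sum by
        additivity.\<close>
      have "f i * e i = G * (f i * e i div G)" if "i \<in> I" for i
      proof -
        have "G dvd f i * e i" unfolding G_eq using that by (intro Gcd_dvd) simp
        then show ?thesis by simp
      qed
      then have "c = (\<Sum>i\<in>I. assoc_eval G (assoc_eval (f i * e i div G) (w i)))"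
        unfolding w(2) by (intro sum.cong) (auto simp flip: assoc_eval_mult)
      moreover have "(\<Sum>i\<in>I. assoc_eval (f i * e i div G) (w i)) \<in> F"
        using w(1) Fc unfolding F_def by (auto simp: assoc_eval_sum_right Pi_iff intro!: sum.neutral)
      ultimately show "c \<in> assoc_eval G ` F" by (auto simp flip: assoc_eval_sum_right)
    next
      \<comment> \<open>The polynomials carrying \<open>F\<close> into the set of values form an
        ideal; it contains the generators of \<open>G\<close>, hence \<open>G\<close>
        itself.\<close>
      let ?P = "\<lambda>p. \<forall>x\<in>F. assoc_eval p x \<in> T ` V"
      have "?P G" unfolding G_eq
      proof (rule Gcd_in_ideal)
        have *: "0 \<in> T ` V" unfolding imT by (auto simp: F_def intro!: bexI[of _ "\<lambda>_. 0"])
        then show "?P 0" by simp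
        show "?P (p + r)" if p: "?P p" and r: "?P r" for p r
        proof
          fix x assume "x \<in> F"
          then obtain w w' where "w \<in> I \<rightarrow> F" "assoc_eval p x = (\<Sum>i\<in>I. assoc_eval (f i * e i) (w i))"
              "w' \<in> I \<rightarrow> F" "assoc_eval r x = (\<Sum>i\<in>I. assoc_eval (f i * e i) (w' i))"
            using p r unfolding imT by meson
          then show "assoc_eval (p + r) x \<in> T ` V"
            unfolding imT q_associate_eval_add_left
            by (intro bexI[of _ "\<lambda>i. w i + w' i"])
              (auto simp: assoc_eval_add_right sum.distrib F_def Pi_iff)
        qed
        show "?P (c * p)" if "?P p" for p c
          using that Fc by (metis assoc_eval_mult mult.commute)
        show "?P p" if p: "p \<in> insert E ((\<lambda>i. f i * e i) ` I)" for p
        proof (cases "p = E")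
          case True
          then show ?thesis using * by (simp add: F_def)
        next
          case False
          then obtain i where i: "i \<in> I" "p = f i * e i" using p by blast
          show ?thesis unfolding imT
          proof
            fix x assume "x \<in> F"
            \<comment> \<open>The tuple with \<open>x\<close> at index \<open>i\<close> and 0
              elsewhere leaves a single summand.\<close>
            then show "\<exists>w\<in>I \<rightarrow> F. assoc_eval p x = (\<Sum>i\<in>I. assoc_eval (f i * e i) (w i))"
              using i by (intro bexI[of _ "\<lambda>j. if j = i then x else 0"])
                (auto simp: F_def if_distrib cong: if_cong)
          qed
        qed
      qed simp
      then show "c \<in> T ` V" if "c \<in> assoc_eval G ` F" for c using that by blast
    qed
    also have "\<dots> = {x. assoc_eval H x = 0}"
      using ker_assoc_eval_factor[OF H0(2), of H] unfolding HG F_def[symmetric] by (rule sym)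
    finally show ?thesis .
  qed

  have finV: "finite V"
    unfolding V_def using d by (intro finite_PiE) (auto simp: coeff_0_x_pow_minus_1 intro!: finite_ker_assoc_eval)
  have cardV: "card V = q ^ (\<Sum>i\<in>I. d i)"
  proof -
    have "card V = (\<Prod>i\<in>I. q ^ d i)"
      unfolding V_def card_PiE[OF I] using d
      by (intro prod.cong) (auto simp: card_ker_assoc_eval coeff_0_x_pow_minus_1 degree_x_pow_minus_1 assms(1))
    then show ?thesis by (simp add: power_sum)
  qed
  have card_fibre: "card {z \<in> V. T z = T w} = card {z \<in> V. T z = 0}" if w: "w \<in> V" for w
  proof (rule bij_betw_same_card[OF bij_betw_byWitness])
    \<comment> \<open>Translation by \<open>w\<close> and its inverse; restricting to
      \<open>I\<close> keeps the tuples extensional.\<close>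
    let ?m = "\<lambda>z. \<lambda>i\<in>I. z i - w i" and ?p = "\<lambda>z. \<lambda>i\<in>I. z i + w i"
    show "\<forall>z\<in>{z \<in> V. T z = T w}. ?p (?m z) = z" "\<forall>z\<in>{z \<in> V. T z = 0}. ?m (?p z) = z"
      by (auto simp: V_def PiE_iff extensional_def fun_eq_iff)
    show "?m ` {z \<in> V. T z = T w} \<subseteq> {z \<in> V. T z = 0}" "?p ` {z \<in> V. T z = 0} \<subseteq> {z \<in> V. T z = T w}"
      using w by (auto simp: V_def PiE_iff T_def assoc_eval_diff_right assoc_eval_add_right
          sum_subtractf sum.distrib)
  qed
  \<comment> \<open>\<open>V\<close> is partitioned by the values of \<open>T\<close>: there are
    \<open>q ^ degree H\<close> of them, and all fibres have the same size.\<close>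
  have count: "card V = q ^ Polynomial.degree H * card {z \<in> V. T z = T w}" if "w \<in> V" for w
  proof -
    have "card V = (\<Sum>c\<in>T ` V. card {z \<in> V. T z = c})"
      using sum.image_gen[OF finV, of "\<lambda>_. 1 :: nat" T] by simp
    also have "\<dots> = (\<Sum>c\<in>T ` V. card {z \<in> V. T z = T w})"
      by (intro sum.cong) (auto simp: card_fibre that)
    also have "\<dots> = card (T ` V) * card {z \<in> V. T z = T w}" by simp
    also have "card (T ` V) = q ^ Polynomial.degree H"
      unfolding image_T assms(1) by (rule card_ker_assoc_eval[OF H0(1)])
    finally show ?thesis .
  qed
  have "real (card {z \<in> V. T z = b}) = real q powi (int (\<Sum>i\<in>I. d i) - int (Polynomial.degree H))"
    if "w \<in> V" "T w = b" for w
  proof -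
    have "real q ^ (\<Sum>i\<in>I. d i) = real q ^ Polynomial.degree H * real (card {z \<in> V. T z = b})"
      using count[OF that(1)] that(2) cardV by (metis of_nat_mult of_nat_power)
    \<comment> \<open>Dividing by the nonzero real \<open>q ^ degree H\<close> turns the product
      formula into a power with integer exponent.\<close>
    then show ?thesis using q by (simp add: power_int_diff del: of_nat_sum)
  qed
  moreover have "(\<exists>z. z \<in> V \<and> T z = b) \<longleftrightarrow> assoc_eval H b = 0"
  proof -
    have "(\<exists>z. z \<in> V \<and> T z = b) \<longleftrightarrow> b \<in> T ` V" by blast
    then show ?thesis by (simp add: image_T)
  qed
  ultimately show ?thesis
    unfolding sol H_def[symmetric] I_def[symmetric] assms(1)[symmetric] mem_Collect_eq by blast
qed

end
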